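(* Let $A\in\mathbb{R}^{n_x\times n_x}$, $B_u\in\mathbb{R}^{n_x\times n_u}$, $B_d\in\mathbb{R}^{n_x\times n_d}$, and symmetric $Q\in\mathbb{R}^{n_x\times n_x}$, $R\in\mathbb{R}^{n_u\times n_u}$ satisfy: (i) $Q\succeq 0$ and $R\succ 0$; (ii) $(A,B_u)$ is stabilizable; (iii) $A$ is nonsingular; (iv) $(A,Q)$ has no unobservable modes on the unit circle. Let $K_{nc}$ be the optimal non-causal controller. For each integer $p\ge 0$ let $\gamma_{R,p}$ denote the minimal (infimal) $\gamma>0$ such that some $p$-step preview controller achieves $\gamma$-regret relative to $K_{nc}$. Then $$\lim_{p\to\infty}\gamma_{R,p}=0,$$ and for any $\hat\epsilon>0$ there exist $p$ and a stabilizing $p$-step preview controller $K_{R,p}$ such that $$0\le J(K_{R,p},d)-J(K_{nc},d)<\hat\epsilon\qquad\text{for all } d\in\ell_2,\ d\neq 0.$$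
   Context: Plant: $x(t+1)=Ax(t)+B_d d(t)+B_u u(t)$, $t=0,1,2,\dots$, with state $x(t)\in\mathbb{R}^{n_x}$, disturbance $d(t)\in\mathbb{R}^{n_d}$, control input $u(t)\in\mathbb{R}^{n_u}$. Here $\ell_2$ is the space of square-summable sequences $d=(d(t))_{t\ge0}$ and $\|d\|_2^2=\sum_{t\ge 0}\|d(t)\|^2$. Cost: for a controller $K$ and $d\in\ell_2$, with initial condition $x(0)=0$, $J(K,d)=\sum_{t=0}^\infty \left( x(t)^\top Qx(t)+u(t)^\top Ru(t)\right)$, where $x,u$ are the closed-loop trajectories generated by $K$ and $d$. A $p$-step preview controller ($p\ge 0$) is a controller that has at time $t$ the information $i_p(t)=\{x(t),d(t),\dots,d(t+p)\}$ and whose output is $u(t)$. A controller is stabilizing if the closed loop is stable. Regret: for $\gamma>0$, a $p$-step preview controller $K_p$ achieves $\gamma$-regret relative to $K_{nc}$ if the closed loop is stable and $J(K_p,d)-J(K_{nc},d)<\gamma^2\|d\|_2^2$ for all $d\in\ell_2$, $d\neq 0$. Optimal non-causal controller: under (i)–(iv) there is a unique stabilizing solution $X\succeq 0$ of the discrete-time algebraic Riccati equation $0=X-A^\top XA-Q+A^\top XB_u(R+B_u^\top XB_u)^{-1}B_u^\top XA$. "Stabilizing" means that $\tilde A:=A-B_uK_x$ is Schur (all eigenvalues in the open unit disk), where $K_x:=(R+B_u^\top XB_u)^{-1}B_u^\top XA$. Let $K_v:=(R+B_u^\top XB_u)^{-1}B_u^\top$. The controller $K_{nc}$, which at time $t$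 has access to $x(t)$ and $d(t),d(t+1),\dots$, is $$u_{nc}(t)=-K_xx(t)-K_v\sum_{j=t}^\infty(\tilde A^\top)^{j-t}XB_d\,d(j).$$ It is known that $J(K_{nc},d)\le J(K,d)$ for every stabilizing controller $K$ and every $d\in\ell_2$.
   Formalization: The final bound is proved as J(K_{R,p},d) − J(K_nc,d) < ε̂‖d‖₂² instead of < ε̂: the bound without ‖d‖₂² fails for all scalar data equal to 1, since a large d(p+1) unseen at time 0 makes the gap unbounded. *)

theory Defs
  imports "HOL-Analysis.Analysis"
begin

definition psd :: "real^'n^'n \<Rightarrow> bool" where
  "psd M \<longleftrightarrow> transpose M = M \<and> (\<forall>v. 0 \<le> v \<bullet> (M *v v))"

definition posdef :: "real^'n^'n \<Rightarrow> bool" where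
  "posdef M \<longleftrightarrow> transpose M = M \<and> (\<forall>v. v \<noteq> 0 \<longrightarrow> 0 < v \<bullet> (M *v v))"

text \<open>Eigenvalues and modes of a real matrix are taken over the complex numbers.\<close>

definition schur :: "real^'n^'n \<Rightarrow> bool" where
  "schur M \<longleftrightarrow>
     (\<forall>(z::complex) v. v \<noteq> 0 \<and> map_matrix complex_of_real M *v v = z *s v \<longrightarrow> cmod z < 1)"

definition stabilizable :: "real^'n^'n \<Rightarrow> real^'m^'n \<Rightarrow> bool" where
  "stabilizable A B \<longleftrightarrow> (\<exists>F::real^'n^'m. schur (A - B ** F))"

definition no_unobservable_modes_on_unit_circle :: "real^'n^'n \<Rightarrow> real^'n^'m \<Rightarrow> bool" where
  "no_unobservable_modes_on_unit_circle A C \<longleftrightarrow>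
     \<not> (\<exists>(z::complex) v. cmod z = 1 \<and> v \<noteq> 0 \<and> map_matrix complex_of_real A *v v = z *s v \<and>
           map_matrix complex_of_real C *v v = 0)"

definition gain_v :: "real^'u^'x \<Rightarrow> real^'u^'u \<Rightarrow> real^'x^'x \<Rightarrow> real^'x^'u" where
  "gain_v Bu R X = matrix_inv (R + transpose Bu ** X ** Bu) ** transpose Bu"

definition gain_x :: "real^'x^'x \<Rightarrow> real^'u^'x \<Rightarrow> real^'u^'u \<Rightarrow> real^'x^'x \<Rightarrow> real^'x^'u" where
  "gain_x A Bu R X = matrix_inv (R + transpose Bu ** X ** Bu) ** transpose Bu ** X ** A"

definition closed_loop_matrix ::
    "real^'x^'x \<Rightarrow> real^'u^'x \<Rightarrow> real^'u^'u \<Rightarrow> real^'x^'x \<Rightarrow> real^'x^'x" where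
  "closed_loop_matrix A Bu R X = A - Bu ** gain_x A Bu R X"

definition stabilizing_dare_solution ::
    "real^'x^'x \<Rightarrow> real^'u^'x \<Rightarrow> real^'x^'x \<Rightarrow> real^'u^'u \<Rightarrow> real^'x^'x \<Rightarrow> bool" where
  "stabilizing_dare_solution A Bu Q R X \<longleftrightarrow>
     psd X \<and>
     0 = X - transpose A ** X ** A - Q
           + transpose A ** X ** Bu ** matrix_inv (R + transpose Bu ** X ** Bu)
               ** transpose Bu ** X ** A \<and>
     schur (closed_loop_matrix A Bu R X)"

definition l2 :: "(nat \<Rightarrow> real^'n) set" where
  "l2 = {d. summable (\<lambda>t. (norm (d t))\<^sup>2)}"

definition energy :: "(nat \<Rightarrow> real^'n) \<Rightarrow> real" where
  "energy d = (\<Sum>t. (norm (d t))\<^sup>2)"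

text \<open>
  A controller may be dynamic, nonlinear and time-varying. At time \<open>t\<close> it maps the list
  \<open>[x(0), \<dots>, x(t)]\<close> of the states measured so far, together with the disturbance signal,
  to the input \<open>u(t)\<close>. Limits on the available part of the disturbance are expressed by
  the predicate \<open>preview_controller\<close>; the time \<open>t\<close> is the length of the list minus one.
\<close>

type_synonym ('x, 'd, 'u) controller =
  "(real^'x) list \<Rightarrow> (nat \<Rightarrow> real^'d) \<Rightarrow> real^'u"

text \<open>
  By time \<open>t\<close> the information sets \<open>i_p(0), \<dots>, i_p(t)\<close> have revealed exactly
  \<open>x(0), \<dots>, x(t)\<close> and \<open>d(0), \<dots>, d(t+p)\<close>.
\<close>

definition preview_controller :: "nat \<Rightarrow> ('x::finite, 'd::finite, 'u::finite) controller \<Rightarrow> bool" where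
  "preview_controller p K \<longleftrightarrow>
     (\<forall>t xs d d'. length xs = t + 1 \<and> (\<forall>s\<le>t + p. d s = d' s) \<longrightarrow> K xs d = K xs d')"

text \<open>The argument \<open>x0\<close> below is the initial condition \<open>x(0)\<close>.\<close>

primrec state_history ::
    "real^'x^'x \<Rightarrow> real^'d^'x \<Rightarrow> real^'u^'x \<Rightarrow> ('x::finite, 'd::finite, 'u::finite) controller
      \<Rightarrow> real^'x \<Rightarrow> (nat \<Rightarrow> real^'d) \<Rightarrow> nat \<Rightarrow> (real^'x) list" where
  "state_history A Bd Bu K x0 d 0 = [x0]"
| "state_history A Bd Bu K x0 d (Suc t) =
     state_history A Bd Bu K x0 d t @
       [A *v last (state_history A Bd Bu K x0 d t) + Bd *v d t
          + Bu *v K (state_history A Bd Bu K x0 d t) d]"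

definition state ::
    "real^'x^'x \<Rightarrow> real^'d^'x \<Rightarrow> real^'u^'x \<Rightarrow> ('x::finite, 'd::finite, 'u::finite) controller
      \<Rightarrow> real^'x \<Rightarrow> (nat \<Rightarrow> real^'d) \<Rightarrow> nat \<Rightarrow> real^'x" where
  "state A Bd Bu K x0 d t = last (state_history A Bd Bu K x0 d t)"

definition control ::
    "real^'x^'x \<Rightarrow> real^'d^'x \<Rightarrow> real^'u^'x \<Rightarrow> ('x::finite, 'd::finite, 'u::finite) controller
      \<Rightarrow> real^'x \<Rightarrow> (nat \<Rightarrow> real^'d) \<Rightarrow> nat \<Rightarrow> real^'u" where
  "control A Bd Bu K x0 d t = K (state_history A Bd Bu K x0 d t) d"

lemma state_dynamics:
  "state A Bd Bu K x0 d 0 = x0"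
  "state A Bd Bu K x0 d (Suc t) =
     A *v state A Bd Bu K x0 d t + Bd *v d t + Bu *v control A Bd Bu K x0 d t"
  by (simp_all add: state_def control_def)

text \<open>
  Since controllers need not have a finite-dimensional state, stability of the closed loop is
  finite-gain \<open>l2\<close> stability from the initial state and the disturbance to the state and the
  input. For a linear time-invariant controller with a stabilizable and detectable realization
  this holds if and only if all closed-loop eigenvalues lie in the open unit disk.
\<close>

definition stabilizing ::
    "real^'x^'x \<Rightarrow> real^'d^'x \<Rightarrow> real^'u^'x \<Rightarrow> ('x::finite, 'd::finite, 'u::finite) controller
      \<Rightarrow> bool" where
  "stabilizing A Bd Bu K \<longleftrightarrow>
     (\<exists>c. \<forall>x0. \<forall>d\<in>l2.
        state A Bd Bu K x0 d \<in> l2 \<and> control A Bd Bu K x0 d \<in> l2 \<and>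
        energy (state A Bd Bu K x0 d) + energy (control A Bd Bu K x0 d)
          \<le> c * ((norm x0)\<^sup>2 + energy d))"

definition cost ::
    "real^'x^'x \<Rightarrow> real^'d^'x \<Rightarrow> real^'u^'x \<Rightarrow> real^'x^'x \<Rightarrow> real^'u^'u
      \<Rightarrow> ('x::finite, 'd::finite, 'u::finite) controller \<Rightarrow> (nat \<Rightarrow> real^'d) \<Rightarrow> real" where
  "cost A Bd Bu Q R K d =
     (\<Sum>t. state A Bd Bu K 0 d t \<bullet> (Q *v state A Bd Bu K 0 d t)
          + control A Bd Bu K 0 d t \<bullet> (R *v control A Bd Bu K 0 d t))"

text \<open>
  The power \<open>^\<close> on the type of square matrices is entrywise, so the matrix powers are written
  as iterates of the linear map; the summation index is \<open>j - t\<close>.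
\<close>

definition noncausal_controller ::
    "real^'x^'x \<Rightarrow> real^'d^'x \<Rightarrow> real^'u^'x \<Rightarrow> real^'u^'u \<Rightarrow> real^'x^'x
      \<Rightarrow> ('x::finite, 'd::finite, 'u::finite) controller" where
  "noncausal_controller A Bd Bu R X xs d =
     - (gain_x A Bu R X *v last xs)
     - gain_v Bu R X *v
         (\<Sum>i. (((*v) (transpose (closed_loop_matrix A Bu R X))) ^^ i)
                 (X *v (Bd *v d (length xs - 1 + i))))"

definition achieves_regret ::
    "real^'x^'x \<Rightarrow> real^'d^'x \<Rightarrow> real^'u^'x \<Rightarrow> real^'x^'x \<Rightarrow> real^'u^'u
      \<Rightarrow> ('x::finite, 'd::finite, 'u::finite) controller
      \<Rightarrow> ('x, 'd, 'u) controller \<Rightarrow> real \<Rightarrow> bool" where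
  "achieves_regret A Bd Bu Q R Knc K \<gamma> \<longleftrightarrow>
     stabilizing A Bd Bu K \<and>
     (\<forall>d\<in>l2. d \<noteq> (\<lambda>t. 0) \<longrightarrow>
        cost A Bd Bu Q R K d - cost A Bd Bu Q R Knc d < \<gamma>\<^sup>2 * energy d)"

text \<open>The infimum is extended real, so that it is \<open>\<infinity>\<close> if no level is achievable.\<close>

definition optimal_regret ::
    "real^'x^'x \<Rightarrow> real^'d^'x \<Rightarrow> real^'u^'x \<Rightarrow> real^'x^'x \<Rightarrow> real^'u^'u
      \<Rightarrow> ('x::finite, 'd::finite, 'u::finite) controller \<Rightarrow> nat \<Rightarrow> ereal" where
  "optimal_regret A Bd Bu Q R Knc p =
     (INF \<gamma>\<in>{\<gamma>::real. \<gamma> > 0 \<and>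
        (\<exists>K. preview_controller p K \<and> achieves_regret A Bd Bu Q R Knc K \<gamma>)}. ereal \<gamma>)"

end

theory Submission
  imports Defs "HOL-Computational_Algebra.Fundamental_Theorem_Algebra"
begin

text \<open>
  Let \<open>v(t)\<close> be the anticipative sum over \<open>i\<close> of \<open>((A\<^sub>c\<^sub>l)\<^sup>T)\<^sup>i X B\<^sub>d d(t + i)\<close> in the optimal non-causal law,
  where \<open>A\<^sub>c\<^sub>l\<close> is the closed-loop matrix \<open>A - B\<^sub>u K\<^sub>x\<close>, and let
  \<open>e(t) = u(t) + K\<^sub>x x(t) + K\<^sub>v v(t)\<close> measure how far an arbitrary controller departs from that law along
  its own trajectory. Completing squares with the Riccati equation (\<open>completion_of_squares\<close>) writes the
  stage cost as \<open>e(t) \<bullet> M e(t)\<close> with \<open>M = R + B\<^sub>u\<^sup>T X B\<^sub>u\<close>, plus a telescoping term, plus a term that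
  depends on the disturbance only. Since \<open>e = 0\<close> for the non-causal controller, the cost gap of every
  stabilizing controller is the sum of the \<open>e(t) \<bullet> M e(t)\<close> (\<open>cost_gap\<close>). In particular it is never
  negative.

  A controller with \<open>p\<close> steps of preview can apply the non-causal law with the series \<open>v(t)\<close> cut off after
  the term \<open>i = p\<close>. Then \<open>e\<close> is \<open>K\<^sub>v\<close> applied to the discarded tail, a convolution of the disturbance with
  the part of the kernel beyond \<open>p\<close>. As \<open>A\<^sub>c\<^sub>l\<close> is Schur, the norms of its powers are summable
  (\<open>schur_summable_power_bound\<close>), so by Young's inequality (\<open>anticausal_convolution_l2\<close>) the gap is at most
  \<open>c(p)\<close> times the energy of the disturbance, where \<open>c(p)\<close> is a constant times the square of the tail of a
  convergent series (\<open>truncated_regret_bound\<close>). Hence \<open>c(p)\<close> tends to zero, which gives both claims.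

  Summability of the powers of a Schur matrix is proved from an annihilating polynomial of a single
  vector, by splitting off linear factors over the complex numbers.
\<close>

section \<open>Summability of the powers of a Schur matrix\<close>

lemma funpow_mult_vec_diff:
  fixes A :: "'a::field^'n^'n"
  shows "((*v) A ^^ k) (A *v v - z *s v) = ((*v) A ^^ Suc k) v - z *s ((*v) A ^^ k) v"
  by (induction k) (simp_all add: matrix_vector_mult_diff_distrib vector_scalar_commute)

lemma funpow_mult_vec_zero:
  fixes A :: "'a::field^'n^'n"
  shows "((*v) A ^^ k) 0 = 0"
  by (induction k) simp_all

text \<open>The first \<open>n + 1\<close> vectors of the orbit of \<open>v\<close> live in an \<open>n\<close>-dimensional space; a linear relation
  between them is a polynomial in \<open>A\<close> that kills \<open>v\<close>.\<close>

lemma exists_annihilating_polynomial: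
  fixes A :: "'a::field^'n^'n"
  shows "\<exists>q::'a poly. q \<noteq> 0 \<and> (\<Sum>i\<le>degree q. coeff q i *s ((*v) A ^^ i) v) = 0"
proof -
  define f where "f i = ((*v) A ^^ i) v" for i
  define n where "n = CARD('n)"
  obtain q :: "'a poly" where q: "q \<noteq> 0" "(\<Sum>i\<le>n. coeff q i *s f i) = 0" "degree q \<le> n"
  proof (cases "inj_on f {..n}")
    case True
    have "vec.dependent (f ` {..n})"
      using dim_subset_UNIV_cart_gen[of "f ` {..n}"] card_image[OF True]
      by (intro vec.dependent_biggerset_general) (simp add: n_def)
    then obtain u w where u: "w \<in> f ` {..n}" "u w \<noteq> 0" "(\<Sum>x\<in>f ` {..n}. u x *s x) = 0"
      by (auto simp: vec.dependent_finite)
    define q where "q = (\<Sum>i\<le>n. monom (u (f i)) i)"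
    have c: "coeff q i = u (f i)" if "i \<le> n" for i
      using that by (simp add: q_def coeff_sum)
    from u obtain k where "k \<le> n" "w = f k" by auto
    hence "coeff q k \<noteq> 0" using c u by simp
    hence "q \<noteq> 0" by auto
    moreover have "(\<Sum>i\<le>n. coeff q i *s f i) = 0"
      using u(3) by (simp add: sum.reindex[OF True] c)
    moreover have "degree q \<le> n" unfolding q_def
      by (intro degree_sum_le) (auto intro: order_trans[OF degree_monom_le])
    ultimately show thesis by (rule that)
  next
    \<comment> \<open>A repeated vector has to be treated apart: linear dependence is a property of the set of
      vectors and does not see repetitions.\<close>
    case False
    then obtain i j where ij: "i \<le> n" "j \<le> n" "i \<noteq> j" "f i = f j"
      by (meson inj_onI atMost_iff)
    define q where "q = monom (1::'a) i - monom 1 j"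
    have "coeff q i \<noteq> 0" using ij by (simp add: q_def)
    hence "q \<noteq> 0" by auto
    moreover have "(\<Sum>k\<le>n. coeff q k *s f k) = 0"
    proof -
      have "(\<Sum>k\<le>n. coeff q k *s f k)
          = (\<Sum>k\<le>n. (if k = i then f k else 0) - (if k = j then f k else 0))"
        by (rule sum.cong) (auto simp: q_def)
      also have "\<dots> = 0" using ij by (simp add: sum_subtractf)
      finally show ?thesis .
    qed
    moreover have "degree q \<le> n" unfolding q_def using ij
      by (meson degree_diff_le degree_monom_le le_trans)
    ultimately show thesis by (rule that)
  qed
  have "(\<Sum>i\<le>degree q. coeff q i *s f i) = (\<Sum>i\<le>n. coeff q i *s f i)"
    by (rule sum.mono_neutral_left) (use q in \<open>auto simp: coeff_eq_0\<close>)
  with q show ?thesis by (auto simp: f_def)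
qed

text \<open>Summing the recursion bounds a partial sum \<open>S\<close> of \<open>a\<close> by \<open>a 0 + r * S\<close> plus the sum of \<open>u\<close>, and
  \<open>r < 1\<close> absorbs the term \<open>r * S\<close>.\<close>

lemma summable_of_contraction_recursion:
  fixes a u :: "nat \<Rightarrow> real"
  assumes "\<And>k. 0 \<le> a k" and "\<And>k. 0 \<le> u k" and u: "summable u"
    and "0 \<le> r" "r < 1" and rec: "\<And>k. a (Suc k) \<le> r * a k + u k"
  shows "summable a"
proof (rule bounded_imp_summable)
  fix n
  have "(\<Sum>k\<le>n. a k) \<le> (a 0 + suminf u) / (1 - r)"
  proof -
    have "(\<Sum>k\<le>n. a k) \<le> (\<Sum>k\<le>Suc n. a k)" using assms(1) by simp
    also have "\<dots> = a 0 + (\<Sum>k\<le>n. a (Suc k))" by (rule sum.atMost_Suc_shift)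
    also have "\<dots> \<le> a 0 + (\<Sum>k\<le>n. r * a k + u k)" by (intro add_left_mono sum_mono rec)
    also have "\<dots> = a 0 + r * (\<Sum>k\<le>n. a k) + (\<Sum>k\<le>n. u k)"
      by (simp add: sum.distrib sum_distrib_left)
    also have "(\<Sum>k\<le>n. u k) \<le> suminf u" by (rule sum_le_suminf) (use assms in auto)
    finally show ?thesis using \<open>r < 1\<close> by (simp add: pos_le_divide_eq algebra_simps)
  qed
  thus "(\<Sum>k\<le>n. a k) \<le> (a 0 + suminf u) / (1 - r)" .
qed (use assms in auto)

text \<open>Split a linear factor \<open>X - z\<close> off the annihilating polynomial and put \<open>w = A v - z v\<close>. The quotient
  annihilates \<open>w\<close>, so the orbit of \<open>w\<close> is summable by induction on the degree, and
  \<open>A\<^sup>k w = (A - z) (A\<^sup>k v)\<close> transfers this to \<open>v\<close>: if \<open>cmod z < 1\<close>, the orbit of \<open>v\<close> obeys a contracting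
  recursion driven by the orbit of \<open>w\<close>; otherwise \<open>z\<close> is no eigenvalue and \<open>A - z\<close> is bounded below.\<close>

lemma summable_orbit_of_annihilating_polynomial:
  fixes A :: "complex^'n^'n"
  assumes eig: "\<And>z v. v \<noteq> 0 \<Longrightarrow> A *v v = z *s v \<Longrightarrow> cmod z < 1"
    and "q \<noteq> 0" and "(\<Sum>i\<le>degree q. coeff q i *s ((*v) A ^^ i) v) = 0"
  shows "summable (\<lambda>k. norm (((*v) A ^^ k) v))"
  using assms(2,3)
proof (induction "degree q" arbitrary: q v)
  case 0
  then obtain c where "q = [:c:]" "c \<noteq> 0" by (metis degree_eq_zeroE pCons_0_0)
  hence "v = 0" using 0 by simp
  thus ?case by (simp add: funpow_mult_vec_zero)
next
  case (Suc n)
  have "\<not> constant (poly q)" using Suc by (simp add: constant_degree)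
  then obtain z where "poly q z = 0" using fundamental_theorem_of_algebra by blast
  then obtain q' where q': "q = [:-z, 1:] * q'" by (auto simp: poly_eq_0_iff_dvd)
  have q'0: "q' \<noteq> 0" using Suc.prems q' by auto
  hence deg: "degree q = Suc (degree q')" unfolding q' by (subst degree_mult_eq) auto
  define w where "w = A *v v - z *s v"
  \<comment> \<open>The coefficients of \<open>q\<close> are those of \<open>q'\<close> moved up by one, minus \<open>z\<close> times those of \<open>q'\<close>.\<close>
  have "(\<Sum>i\<le>degree q. coeff q i *s ((*v) A ^^ i) v)
      = (\<Sum>i\<le>Suc (degree q'). (case i of 0 \<Rightarrow> 0 | Suc j \<Rightarrow> coeff q' j) *s ((*v) A ^^ i) v)
        - (\<Sum>i\<le>Suc (degree q'). (z * coeff q' i) *s ((*v) A ^^ i) v)"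
    unfolding deg sum_subtractf[symmetric]
    by (rule sum.cong) (auto simp: q' coeff_pCons algebra_simps vector_sub_rdistrib split: nat.split)
  also have "\<dots> = (\<Sum>i\<le>degree q'. coeff q' i *s ((*v) A ^^ Suc i) v)
                 - (\<Sum>i\<le>degree q'. (z * coeff q' i) *s ((*v) A ^^ i) v)"
    by (subst sum.atMost_Suc_shift) (simp add: coeff_eq_0)
  also have "\<dots> = (\<Sum>i\<le>degree q'. coeff q' i *s ((*v) A ^^ i) w)"
    unfolding w_def funpow_mult_vec_diff
    by (simp add: sum_subtractf[symmetric] vector_ssub_ldistrib vector_smult_assoc mult.commute)
  finally have "(\<Sum>i\<le>degree q'. coeff q' i *s ((*v) A ^^ i) w) = 0" using Suc.prems by simp
  hence sw: "summable (\<lambda>k. norm (((*v) A ^^ k) w))"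
    using Suc.hyps deg q'0 by simp
  show ?case
  proof (cases "cmod z < 1")
    case True
    show ?thesis
    proof (rule summable_of_contraction_recursion[OF _ _ sw _ True])
      fix k
      have "((*v) A ^^ Suc k) v = z *s ((*v) A ^^ k) v + ((*v) A ^^ k) w"
        unfolding w_def funpow_mult_vec_diff by simp
      moreover have "norm (z *s x) = cmod z * norm x" for x :: "complex^'n"
        by (simp add: norm_vec_def L2_set_def norm_mult power_mult_distrib sum_distrib_left[symmetric]
             real_sqrt_mult)
      ultimately show "norm (((*v) A ^^ Suc k) v) \<le> cmod z * norm (((*v) A ^^ k) v) + norm (((*v) A ^^ k) w)"
        by (metis norm_triangle_ineq)
    qed auto
  next
    case False
    define L where "L = (\<lambda>x. A *v x - z *s x)"
    have lin: "linear L"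
      unfolding L_def
      by (intro linear_compose_sub matrix_vector_mul_linear linearI)
        (simp_all add: vector_add_ldistrib vec_eq_iff)
    have "inj L"
      using lin by (auto simp: linear_injective_0 L_def dest: eig) (use eig False in blast)
    then obtain B where B: "B > 0" "\<And>x. B * norm x \<le> norm (L x)"
      using linear_inj_bounded_below_pos[OF lin] by blast
    have "L (((*v) A ^^ k) v) = ((*v) A ^^ k) w" for k
      unfolding L_def w_def funpow_mult_vec_diff by simp
    hence "norm (((*v) A ^^ k) v) \<le> norm (((*v) A ^^ k) w) / B" for k
      using B by (metis mult.commute pos_le_divide_eq)
    thus ?thesis using summable_divide[OF sw, of B]
      by (auto intro: summable_comparison_test'[where N = 0 and g = "\<lambda>k. norm (((*v) A ^^ k) w) / B"])
  qed
qed

text \<open>The embedding of real into complex vectors is isometric and intertwines the real matrix with its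
  complex counterpart, so orbits keep their norms.\<close>

lemma schur_summable_orbit:
  fixes M :: "real^'n^'n"
  assumes "schur M"
  shows "summable (\<lambda>k. norm (((*v) M ^^ k) v))"
proof -
  define C where "C = (\<lambda>x::real^'n. (\<chi> i. complex_of_real (x $ i)))"
  define A where "A = map_matrix complex_of_real M"
  have com: "C (M *v x) = A *v C x" for x
    by (simp add: C_def A_def vec_eq_iff matrix_vector_mult_def map_matrix_def)
  have orbit: "((*v) A ^^ k) (C v) = C (((*v) M ^^ k) v)" for k
    by (induction k) (simp_all add: com)
  have norm_C: "norm (C x) = norm x" for x
    by (simp add: C_def norm_vec_def)
  have eig: "cmod z < 1" if "w \<noteq> 0" "A *v w = z *s w" for z w
    using assms that unfolding schur_def A_def by blast
  obtain q where "q \<noteq> 0" "(\<Sum>i\<le>degree q. coeff q i *s ((*v) A ^^ i) (C v)) = 0"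
    using exists_annihilating_polynomial by blast
  hence "summable (\<lambda>k. norm (((*v) A ^^ k) (C v)))"
    by (intro summable_orbit_of_annihilating_polynomial eig)
  thus ?thesis by (simp add: orbit norm_C)
qed

lemma inner_transpose:
  fixes M :: "real^'n^'m"
  shows "(transpose M *v x) \<bullet> y = x \<bullet> (M *v y)"
  by (simp add: dot_lmul_matrix)

lemma inner_transpose_right:
  fixes M :: "real^'n^'m"
  shows "y \<bullet> (transpose M *v x) = (M *v y) \<bullet> x"
  by (metis inner_transpose inner_commute)

lemma inner_matrix_sym:
  fixes M :: "real^'n^'n"
  assumes "transpose M = M"
  shows "(M *v x) \<bullet> y = x \<bullet> (M *v y)"
  by (metis assms inner_transpose)

lemma inner_funpow_transpose:
  fixes M :: "real^'n^'n"
  shows "((*v) (transpose M) ^^ k) x \<bullet> y = x \<bullet> ((*v) M ^^ k) y"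
proof (induction k arbitrary: y)
  case (Suc k)
  have "((*v) (transpose M) ^^ Suc k) x \<bullet> y = ((*v) (transpose M) ^^ k) x \<bullet> (M *v y)"
    by (simp add: inner_transpose del: transpose_matrix_vector)
  also have "\<dots> = x \<bullet> ((*v) M ^^ Suc k) y" by (simp only: Suc funpow_Suc_right o_apply)
  finally show ?case .
qed simp

lemma linear_funpow_mult_vec:
  fixes M :: "real^'n^'n"
  shows "linear ((*v) M ^^ k)"
proof (induction k)
  case 0 show ?case by (simp add: linear_id[unfolded id_def] id_def)
next
  case (Suc k)
  thus ?case using linear_compose[OF Suc matrix_vector_mul_linear[of M]] by (simp add: o_def)
qed

text \<open>One sequence bounds the powers of \<open>M\<close> and of its transpose: an operator and its adjoint have the same
  norm.\<close>

lemma schur_summable_power_bound: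
  fixes M :: "real^'n^'n"
  assumes "schur M"
  obtains h where "\<And>k. 0 \<le> h k" and "summable h"
    and "\<And>k x. norm (((*v) M ^^ k) x) \<le> h k * norm x"
    and "\<And>k x. norm (((*v) (transpose M) ^^ k) x) \<le> h k * norm x"
proof -
  define h where "h k = (\<Sum>b\<in>Basis. norm (((*v) M ^^ k) b))" for k
  have 1: "0 \<le> h k" for k by (simp add: h_def sum_nonneg)
  have 2: "summable h" unfolding h_def by (intro summable_sum schur_summable_orbit assms)
  have 3: "norm (((*v) M ^^ k) x) \<le> h k * norm x" for k x
  proof -
    have "((*v) M ^^ k) x = ((*v) M ^^ k) (\<Sum>b\<in>Basis. (x \<bullet> b) *\<^sub>R b)"
      by (simp add: euclidean_representation)
    also have "\<dots> = (\<Sum>b\<in>Basis. (x \<bullet> b) *\<^sub>R ((*v) M ^^ k) b)"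
      by (simp add: linear_sum[OF linear_funpow_mult_vec] linear_cmul[OF linear_funpow_mult_vec])
    also have "norm \<dots> \<le> (\<Sum>b\<in>Basis. norm (((*v) M ^^ k) b) * norm x)"
      by (intro sum_norm_le) (auto simp: mult.commute Basis_le_norm intro!: mult_right_mono)
    finally show ?thesis by (simp add: h_def sum_distrib_right)
  qed
  have 4: "norm (((*v) (transpose M) ^^ k) x) \<le> h k * norm x" for k x
  proof -
    define y where "y = ((*v) (transpose M) ^^ k) x"
    have "norm y * norm y = y \<bullet> y" by (simp add: power2_norm_eq_inner[symmetric] power2_eq_square)
    also have "\<dots> = x \<bullet> ((*v) M ^^ k) y"
      by (subst (1) y_def) (rule inner_funpow_transpose)
    also have "\<dots> \<le> norm x * norm (((*v) M ^^ k) y)" by (rule norm_cauchy_schwarz)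
    also have "\<dots> \<le> norm x * (h k * norm y)" by (intro mult_left_mono 3) auto
    finally have "norm y * norm y \<le> (h k * norm x) * norm y" by (simp add: mult.assoc mult.left_commute)
    thus ?thesis using 1[of k] unfolding y_def[symmetric]
      by (cases "y = 0") auto
  qed
  show thesis using 1 2 3 4 by (rule that)
qed

section \<open>Convolution with summable kernels on square-summable sequences\<close>

text \<open>Young's inequality for the convolution of \<open>\<ell>\<^sub>1\<close> and \<open>\<ell>\<^sub>2\<close>, in a form that does not fix the index shift:
  \<open>a t i\<close> stands for the norm of a signal shifted by \<open>i\<close>, to the left for anticausal and to the right for
  causal convolution, and the hypothesis on \<open>E\<close> says that no shift increases the energy.\<close>

lemma weighted_young_finite:
  fixes g :: "'i \<Rightarrow> real"
  assumes "finite I" and g: "\<And>i. i \<in> I \<Longrightarrow> 0 \<le> g i" and G: "sum g I \<le> G" and "0 \<le> E"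
    and E: "\<And>i. i \<in> I \<Longrightarrow> (\<Sum>t\<in>S. (a t i)\<^sup>2) \<le> E"
  shows "(\<Sum>t\<in>S. (\<Sum>i\<in>I. g i * a t i)\<^sup>2) \<le> G\<^sup>2 * E"
proof -
  have G0: "0 \<le> sum g I" by (rule sum_nonneg) (rule g)
  have "(\<Sum>i\<in>I. g i * a t i)\<^sup>2 \<le> sum g I * (\<Sum>i\<in>I. g i * (a t i)\<^sup>2)" for t
  proof -
    have "(\<Sum>i\<in>I. g i * a t i) = (\<Sum>i\<in>I. sqrt (g i) * (sqrt (g i) * a t i))"
      by (rule sum.cong) (auto simp: g mult.assoc[symmetric])
    also have "\<dots>\<^sup>2 \<le> (\<Sum>i\<in>I. (sqrt (g i))\<^sup>2) * (\<Sum>i\<in>I. (sqrt (g i) * a t i)\<^sup>2)"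
      by (rule Cauchy_Schwarz_ineq_sum)
    also have "\<dots> = sum g I * (\<Sum>i\<in>I. g i * (a t i)\<^sup>2)"
      by (simp add: g power_mult_distrib)
    finally show ?thesis .
  qed
  hence "(\<Sum>t\<in>S. (\<Sum>i\<in>I. g i * a t i)\<^sup>2) \<le> (\<Sum>t\<in>S. sum g I * (\<Sum>i\<in>I. g i * (a t i)\<^sup>2))"
    by (rule sum_mono)
  also have "\<dots> = sum g I * (\<Sum>i\<in>I. g i * (\<Sum>t\<in>S. (a t i)\<^sup>2))"
    unfolding sum_distrib_left[symmetric] by (subst sum.swap) (simp add: sum_distrib_left)
  also have "\<dots> \<le> sum g I * (\<Sum>i\<in>I. g i * E)"
    by (intro mult_left_mono sum_mono E g G0)
  also have "\<dots> = (sum g I)\<^sup>2 * E" by (simp add: sum_distrib_right[symmetric] power2_eq_square)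
  also have "\<dots> \<le> G\<^sup>2 * E"
    using G G0 \<open>0 \<le> E\<close> by (intro mult_right_mono power_mono)
  finally show ?thesis .
qed

lemma l2_of_bounded_partial_energy:
  assumes "\<And>T. (\<Sum>t<T. (norm (d t))\<^sup>2) \<le> E"
  shows "d \<in> l2" and "energy d \<le> E"
proof -
  show d: "d \<in> l2"
    using assms unfolding l2_def by (auto intro: summableI_nonneg_bounded[of _ E])
  show "energy d \<le> E"
    using d unfolding energy_def l2_def by (auto intro: suminf_le_const assms)
qed

lemma energy_nonneg: "d \<in> l2 \<Longrightarrow> 0 \<le> energy d"
  by (simp add: energy_def l2_def suminf_nonneg)

lemma energy_pos:
  assumes "d \<in> l2" and "d \<noteq> (\<lambda>t. 0)"
  shows "0 < energy d"
proof -
  obtain t where "d t \<noteq> 0" using assms(2) by auto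
  thus ?thesis using assms(1) unfolding energy_def l2_def by (auto intro: suminf_pos2[of _ t])
qed

lemma sum_reindexed_le_energy:
  assumes "d \<in> l2" and "inj_on \<tau> S" and "finite S"
  shows "(\<Sum>t\<in>S. (norm (d (\<tau> t)))\<^sup>2) \<le> energy d"
proof -
  have "(\<Sum>t\<in>S. (norm (d (\<tau> t)))\<^sup>2) = (\<Sum>t\<in>\<tau> ` S. (norm (d t))\<^sup>2)"
    by (simp add: sum.reindex[OF assms(2)])
  also have "\<dots> \<le> energy d"
    unfolding energy_def using assms by (intro sum_le_suminf) (auto simp: l2_def)
  finally show ?thesis .
qed

lemma norm_le_sqrt_energy: "d \<in> l2 \<Longrightarrow> norm (d t) \<le> sqrt (energy d)"
  using sum_reindexed_le_energy[of d "\<lambda>t. t" "{t}"] by (auto intro: real_le_rsqrt)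

lemma l2_tendsto_0:
  assumes "d \<in> l2"
  shows "d \<longlonglongrightarrow> 0"
proof -
  have "(\<lambda>t. sqrt ((norm (d t))\<^sup>2)) \<longlonglongrightarrow> sqrt 0"
    using assms unfolding l2_def by (intro tendsto_real_sqrt summable_LIMSEQ_zero) simp
  thus ?thesis by (simp add: tendsto_norm_zero_iff)
qed

text \<open>The factors 2 come from \<open>(a + b)\<^sup>2 \<le> 2 a\<^sup>2 + 2 b\<^sup>2\<close>.\<close>

lemma l2_dominated:
  assumes a: "a \<in> l2" and b: "b \<in> l2"
    and le: "\<And>t. norm (c t) \<le> \<alpha> * norm (a t) + \<beta> * norm (b t)"
  shows "c \<in> l2" and "energy c \<le> 2 * \<alpha>\<^sup>2 * energy a + 2 * \<beta>\<^sup>2 * energy b"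
proof -
  have "(\<Sum>t<T. (norm (c t))\<^sup>2) \<le> 2 * \<alpha>\<^sup>2 * energy a + 2 * \<beta>\<^sup>2 * energy b" for T
  proof -
    have "(norm (c t))\<^sup>2 \<le> 2 * \<alpha>\<^sup>2 * (norm (a t))\<^sup>2 + 2 * \<beta>\<^sup>2 * (norm (b t))\<^sup>2" for t
    proof -
      have "(norm (c t))\<^sup>2 \<le> (\<alpha> * norm (a t) + \<beta> * norm (b t))\<^sup>2"
        using le by (intro power_mono) auto
      also have "\<dots> \<le> 2 * (\<alpha> * norm (a t))\<^sup>2 + 2 * (\<beta> * norm (b t))\<^sup>2"
        using sum_squares_bound[of "\<alpha> * norm (a t)" "\<beta> * norm (b t)"] by (simp add: power2_sum)
      finally show ?thesis by (simp add: power_mult_distrib)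
    qed
    hence "(\<Sum>t<T. (norm (c t))\<^sup>2)
        \<le> (\<Sum>t<T. 2 * \<alpha>\<^sup>2 * (norm (a t))\<^sup>2 + 2 * \<beta>\<^sup>2 * (norm (b t))\<^sup>2)"
      by (rule sum_mono)
    also have "\<dots> = 2 * \<alpha>\<^sup>2 * (\<Sum>t<T. (norm (a t))\<^sup>2) + 2 * \<beta>\<^sup>2 * (\<Sum>t<T. (norm (b t))\<^sup>2)"
      by (simp add: sum.distrib sum_distrib_left)
    also have "\<dots> \<le> 2 * \<alpha>\<^sup>2 * energy a + 2 * \<beta>\<^sup>2 * energy b"
      using sum_reindexed_le_energy[OF a, of "\<lambda>t. t" "{..<T}"]
        sum_reindexed_le_energy[OF b, of "\<lambda>t. t" "{..<T}"]
      by (intro add_mono mult_left_mono) auto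
    finally show ?thesis .
  qed
  thus "c \<in> l2" and "energy c \<le> 2 * \<alpha>\<^sup>2 * energy a + 2 * \<beta>\<^sup>2 * energy b"
    by (rule l2_of_bounded_partial_energy)+
qed

text \<open>The finite inequality bounds the partial sums of the convolution; their limit is taken for a fixed
  number \<open>T\<close> of time steps, which takes the place of interchanging two infinite sums.\<close>

lemma anticausal_convolution_l2:
  fixes H :: "nat \<Rightarrow> real^'m \<Rightarrow> real^'n"
  assumes h: "\<And>i. 0 \<le> h i" "summable h" and H: "\<And>i x. norm (H i x) \<le> h i * norm x"
    and d: "d \<in> l2"
  shows "summable (\<lambda>i. H i (d (t + i)))"
    and "(\<lambda>t. \<Sum>i. H i (d (t + i))) \<in> l2"
    and "energy (\<lambda>t. \<Sum>i. H i (d (t + i))) \<le> (suminf h)\<^sup>2 * energy d"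
proof -
  show sm: "summable (\<lambda>i. H i (d (t + i)))" for t
  proof (rule summable_comparison_test')
    show "summable (\<lambda>i. h i * sqrt (energy d))" using h by (intro summable_mult2)
    show "norm (H i (d (t + i))) \<le> h i * sqrt (energy d)" for i
      using H[of i "d (t + i)"] mult_left_mono[OF norm_le_sqrt_energy[OF d, of "t + i"] h(1)[of i]]
      by linarith
  qed
  have "(\<Sum>t<T. (norm (\<Sum>i. H i (d (t + i))))\<^sup>2) \<le> (suminf h)\<^sup>2 * energy d" for T
  proof (rule LIMSEQ_le_const2)
    show "(\<lambda>N. \<Sum>t<T. (norm (\<Sum>i<N. H i (d (t + i))))\<^sup>2)
        \<longlonglongrightarrow> (\<Sum>t<T. (norm (\<Sum>i. H i (d (t + i))))\<^sup>2)"
      by (intro tendsto_intros summable_LIMSEQ sm)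
    have "(\<Sum>t<T. (norm (\<Sum>i<N. H i (d (t + i))))\<^sup>2) \<le> (suminf h)\<^sup>2 * energy d" for N
    proof -
      have "norm (\<Sum>i<N. H i (d (t + i))) \<le> (\<Sum>i<N. h i * norm (d (t + i)))" for t
        by (intro sum_norm_le H)
      hence "(\<Sum>t<T. (norm (\<Sum>i<N. H i (d (t + i))))\<^sup>2) \<le> (\<Sum>t<T. (\<Sum>i<N. h i * norm (d (t + i)))\<^sup>2)"
        by (intro sum_mono power_mono) auto
      also have "\<dots> \<le> (suminf h)\<^sup>2 * energy d"
        using h d by (intro weighted_young_finite sum_le_suminf energy_nonneg sum_reindexed_le_energy)
          (auto simp: inj_on_def)
      finally show ?thesis .
    qed
    thus "\<exists>N0. \<forall>N\<ge>N0. (\<Sum>t<T. (norm (\<Sum>i<N. H i (d (t + i))))\<^sup>2) \<le> (suminf h)\<^sup>2 * energy d"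
      by blast
  qed
  thus "(\<lambda>t. \<Sum>i. H i (d (t + i))) \<in> l2"
    and "energy (\<lambda>t. \<Sum>i. H i (d (t + i))) \<le> (suminf h)\<^sup>2 * energy d"
    by (rule l2_of_bounded_partial_energy)+
qed

text \<open>The initial state is stored in \<open>b 0\<close>. Then the state is a causal convolution of \<open>b\<close> with the powers of
  \<open>F\<close>, and one estimate covers both the initial state and the input.\<close>

lemma stable_recursion_l2:
  fixes F :: "real^'n^'n"
  assumes h: "\<And>i. 0 \<le> h i" "summable h"
    and F: "\<And>k x. norm (((*v) F ^^ k) x) \<le> h k * norm x"
    and b: "b \<in> l2"
    and x0: "x 0 = b 0" and rec: "\<And>t. x (Suc t) = F *v x t + b (Suc t)"
  shows "x \<in> l2" and "energy x \<le> (suminf h)\<^sup>2 * energy b"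
proof -
  have x: "x t = (\<Sum>i\<le>t. ((*v) F ^^ i) (b (t - i)))" for t
  proof (induction t)
    case (Suc t)
    have "x (Suc t) = (\<Sum>i\<le>t. ((*v) F ^^ Suc i) (b (t - i))) + b (Suc t)"
      by (simp add: rec Suc linear_sum[OF matrix_vector_mul_linear])
    also have "\<dots> = (\<Sum>i\<le>Suc t. ((*v) F ^^ i) (b (Suc t - i)))"
      by (subst sum.atMost_Suc_shift) simp
    finally show ?case .
  qed (simp add: x0)
  have "(\<Sum>t<T. (norm (x t))\<^sup>2) \<le> (suminf h)\<^sup>2 * energy b" for T
  proof -
    define a where "a t i = (if i \<le> t then norm (b (t - i)) else 0)" for t i
    have "norm (x t) \<le> (\<Sum>i<T. h i * a t i)" if "t < T" for t
    proof -
      have "norm (x t) \<le> (\<Sum>i\<le>t. h i * a t i)"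
        unfolding x by (intro sum_norm_le) (auto simp: a_def F)
      also have "\<dots> \<le> (\<Sum>i<T. h i * a t i)"
        using that h by (intro sum_mono2) (auto simp: a_def)
      finally show ?thesis .
    qed
    hence "(\<Sum>t<T. (norm (x t))\<^sup>2) \<le> (\<Sum>t<T. (\<Sum>i<T. h i * a t i)\<^sup>2)"
      by (intro sum_mono power_mono) auto
    also have "\<dots> \<le> (suminf h)\<^sup>2 * energy b"
    proof (intro weighted_young_finite sum_le_suminf energy_nonneg)
      fix i
      have "(\<Sum>t<T. (a t i)\<^sup>2) = (\<Sum>t\<in>{i..<T}. (norm (b (t - i)))\<^sup>2)"
        by (rule sum.mono_neutral_cong_right) (auto simp: a_def)
      also have "\<dots> \<le> energy b"
        using b by (intro sum_reindexed_le_energy) (auto simp: inj_on_def)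
      finally show "(\<Sum>t<T. (a t i)\<^sup>2) \<le> energy b" .
    qed (use h b in auto)
    finally show ?thesis .
  qed
  thus "x \<in> l2" and "energy x \<le> (suminf h)\<^sup>2 * energy b"
    by (rule l2_of_bounded_partial_energy)+
qed

lemma norm_mult_vec_le:
  fixes M :: "real^'n^'m"
  shows "norm (M *v x) \<le> onorm ((*v) M) * norm x"
  by (rule onorm) (rule matrix_vector_mul_bounded_linear)

lemma suminf_tail_tendsto_0:
  fixes h :: "nat \<Rightarrow> real"
  assumes "summable h"
  shows "(\<lambda>p. \<Sum>i. if i \<le> p then 0 else h i) \<longlonglongrightarrow> 0"
proof -
  have "(\<Sum>i. if i \<le> p then 0 else h i) = suminf h - (\<Sum>i\<le>p. h i)" for p
  proof -
    have "(\<lambda>i. h i - (if i \<in> {..p} then h i else 0)) sums (suminf h - (\<Sum>i\<in>{..p}. h i))"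
      using assms by (intro sums_diff sums_If_finite_set summable_sums) auto
    moreover have "(\<lambda>i. h i - (if i \<in> {..p} then h i else 0)) = (\<lambda>i. if i \<le> p then 0 else h i)"
      by auto
    ultimately show ?thesis by (simp add: sums_iff)
  qed
  moreover have "(\<lambda>p. suminf h - (\<Sum>i\<le>p. h i)) \<longlonglongrightarrow> suminf h - suminf h"
    using summable_LIMSEQ'[OF assms] by (intro tendsto_intros)
  ultimately show ?thesis by simp
qed

lemma summable_quadratic_form:
  fixes P :: "real^'n^'n"
  assumes "x \<in> l2"
  shows "summable (\<lambda>t. x t \<bullet> (P *v x t))"
proof (rule summable_comparison_test')
  show "summable (\<lambda>t. onorm ((*v) P) * (norm (x t))\<^sup>2)"
    using assms unfolding l2_def by (intro summable_mult) simp
  fix t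
  have "\<bar>x t \<bullet> (P *v x t)\<bar> \<le> norm (x t) * norm (P *v x t)" by (rule Cauchy_Schwarz_ineq2)
  also have "\<dots> \<le> norm (x t) * (onorm ((*v) P) * norm (x t))"
    by (intro mult_left_mono norm_mult_vec_le) auto
  finally show "norm (x t \<bullet> (P *v x t)) \<le> onorm ((*v) P) * (norm (x t))\<^sup>2"
    by (simp add: power2_eq_square mult.left_commute)
qed

lemma quadratic_form_suminf_le:
  fixes P :: "real^'n^'n"
  assumes "x \<in> l2"
  shows "(\<Sum>t. x t \<bullet> (P *v x t)) \<le> onorm ((*v) P) * energy x"
proof -
  have "x t \<bullet> (P *v x t) \<le> onorm ((*v) P) * (norm (x t))\<^sup>2" for t
  proof -
    have "x t \<bullet> (P *v x t) \<le> norm (x t) * norm (P *v x t)" by (rule norm_cauchy_schwarz)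
    also have "\<dots> \<le> norm (x t) * (onorm ((*v) P) * norm (x t))"
      by (intro mult_left_mono norm_mult_vec_le) auto
    finally show ?thesis by (simp add: power2_eq_square mult.left_commute)
  qed
  hence "(\<Sum>t. x t \<bullet> (P *v x t)) \<le> (\<Sum>t. onorm ((*v) P) * (norm (x t))\<^sup>2)"
    using assms by (intro suminf_le summable_quadratic_form) (auto simp: l2_def)
  also have "\<dots> = onorm ((*v) P) * energy x"
    using assms unfolding energy_def l2_def by (intro suminf_mult) simp
  finally show ?thesis .
qed

section \<open>The Riccati equation and completion of squares\<close>

lemma posdef_mult_matrix_inv:
  fixes M :: "real^'n^'n"
  assumes "posdef M"
  shows "M ** matrix_inv M = mat 1"
proof -
  have "\<forall>x. M *v x = 0 \<longrightarrow> x = 0" using assms unfolding posdef_def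
    by (metis inner_zero_right less_irrefl)
  hence "\<exists>M'. M ** M' = mat 1 \<and> M' ** M = mat 1"
    by (metis matrix_left_invertible_ker matrix_left_right_inverse)
  thus ?thesis unfolding matrix_inv_def by (rule someI2_ex) auto
qed

lemma length_state_history: "length (state_history A Bd Bu K x0 d t) = t + 1"
  by (induction t) auto

locale dare_solution =
  fixes A :: "real^'x^'x" and Bd :: "real^'d^'x" and Bu :: "real^'u^'x"
    and Q :: "real^'x^'x" and R :: "real^'u^'u" and X :: "real^'x^'x"
  assumes posdef_R: "posdef R"
    and dare: "stabilizing_dare_solution A Bu Q R X"
begin

abbreviation "Kx \<equiv> gain_x A Bu R X"
abbreviation "Kv \<equiv> gain_v Bu R X"
abbreviation "Acl \<equiv> closed_loop_matrix A Bu R X"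

text \<open>The Hessian, up to a factor two, of the one-step cost-to-go as a function of the input.\<close>

definition M :: "real^'u^'u" where "M = R + transpose Bu ** X ** Bu"

lemma X_sym: "transpose X = X" and X_nonneg: "0 \<le> v \<bullet> (X *v v)"
  using dare by (auto simp: stabilizing_dare_solution_def psd_def)

lemma M_quadratic: "v \<bullet> (M *v v) = v \<bullet> (R *v v) + (Bu *v v) \<bullet> (X *v (Bu *v v))"
  by (simp add: M_def matrix_vector_mult_add_rdistrib inner_add_right matrix_vector_mul_assoc[symmetric]
      inner_transpose_right del: transpose_matrix_vector)

lemma posdef_M: "posdef M"
proof -
  have "transpose (P + P') = transpose P + transpose P'" for P P' :: "real^'u^'u"
    by (simp add: transpose_def vec_eq_iff)
  hence "transpose M = M"
    using posdef_R by (simp add: M_def posdef_def matrix_transpose_mul X_sym matrix_mul_assoc)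
  thus ?thesis using posdef_R X_nonneg unfolding posdef_def M_quadratic by (simp add: add_pos_nonneg)
qed

lemma M_nonneg: "0 \<le> v \<bullet> (M *v v)"
  using posdef_M by (cases "v = 0") (auto simp: posdef_def less_imp_le)

lemma M_Kv: "M *v (Kv *v v) = transpose Bu *v v"
  by (simp only: gain_v_def matrix_vector_mul_assoc matrix_mul_assoc M_def[symmetric]
      posdef_mult_matrix_inv[OF posdef_M] matrix_mul_lid)

lemma Kx_Kv: "Kx *v x = Kv *v (X *v (A *v x))"
  by (simp only: gain_x_def gain_v_def matrix_vector_mul_assoc matrix_mul_assoc)

text \<open>The quadratic form of the Riccati equation. Since \<open>M Kx = Bu\<^sup>T X A\<close>, its last term is the \<open>M\<close>-weighted
  square of the feedback \<open>Kx x\<close>.\<close>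

lemma dare_quadratic:
  "(A *v x) \<bullet> (X *v (A *v x)) + x \<bullet> (Q *v x) - x \<bullet> (X *v x) = (Kx *v x) \<bullet> (M *v (Kx *v x))"
proof -
  have "0 = x \<bullet> ((X - transpose A ** X ** A - Q
      + transpose A ** X ** Bu ** matrix_inv M ** transpose Bu ** X ** A) *v x)"
    using dare unfolding stabilizing_dare_solution_def M_def by (metis inner_zero_right matrix_vector_mult_0)
  also have "\<dots> = x \<bullet> (X *v x) - (A *v x) \<bullet> (X *v (A *v x)) - x \<bullet> (Q *v x)
      + (A *v x) \<bullet> (X *v (Bu *v (Kx *v x)))"
    unfolding gain_x_def M_def[symmetric]
    by (simp add: matrix_vector_mult_add_rdistrib matrix_vector_mult_diff_rdistrib inner_add_right
        inner_diff_right matrix_vector_mul_assoc[symmetric] inner_transpose[symmetric]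
        inner_commute[of x] dot_lmul_matrix inner_commute[of _ "A *v x"] del: transpose_matrix_vector)
  also have "(A *v x) \<bullet> (X *v (Bu *v (Kx *v x))) = (transpose Bu *v (X *v (A *v x))) \<bullet> (Kx *v x)"
    by (metis inner_transpose X_sym)
  also have "\<dots> = (Kx *v x) \<bullet> (M *v (Kx *v x))"
    unfolding Kx_Kv M_Kv by (rule inner_commute)
  finally show ?thesis by simp
qed

text \<open>Dynamic programming for a disturbance that is known in advance: the cost-to-go from \<open>x\<close> is
  \<open>x \<bullet> X x + 2 (x \<bullet> g)\<close> plus a term that depends on the disturbance alone, where \<open>g\<close> comes from the
  backward recursion in the first two hypotheses. Minimizing over \<open>u\<close> gives \<open>- Kx x - Kv v\<close>, and \<open>e\<close> is
  the departure from this minimizer. All that remains on the right-hand side besides \<open>e \<bullet> M e\<close> is free of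
  \<open>x\<close> and \<open>u\<close>, so it is the same for any two controllers.\<close>

lemma completion_of_squares:
  assumes v: "v = X *v w + g'" and g: "g = transpose Acl *v v"
    and x': "x' = A *v x + w + Bu *v u" and e: "e = u + Kx *v x + Kv *v v"
  shows "x \<bullet> (Q *v x) + u \<bullet> (R *v u) + (x' \<bullet> (X *v x') + 2 * (x' \<bullet> g'))
       - (x \<bullet> (X *v x) + 2 * (x \<bullet> g))
       = e \<bullet> (M *v e) + (w \<bullet> (X *v w) + 2 * (w \<bullet> g') - (Kv *v v) \<bullet> (M *v (Kv *v v)))"
proof -
  define k l y where "k = Kx *v x" and "l = Kv *v v" and "y = A *v x"
  have Bk: "(Bu *v c) \<bullet> (X *v y) = c \<bullet> (M *v k)" for c
    unfolding k_def y_def Kx_Kv M_Kv by (metis inner_transpose inner_commute)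
  have Bl: "(Bu *v c) \<bullet> v = c \<bullet> (M *v l)" for c
    unfolding l_def M_Kv by (metis inner_transpose inner_commute)
  have Xsym: "a \<bullet> (X *v b) = b \<bullet> (X *v a)" for a b
    by (metis X_sym inner_matrix_sym inner_commute)
  have Msym: "a \<bullet> (M *v b) = b \<bullet> (M *v a)" for a b
    using posdef_M unfolding posdef_def by (metis inner_matrix_sym inner_commute)
  have xg: "x \<bullet> g = y \<bullet> v - k \<bullet> (M *v l)"
  proof -
    have "x \<bullet> g = (Acl *v x) \<bullet> v" unfolding g by (metis inner_transpose inner_commute)
    also have "Acl *v x = y - Bu *v k"
      by (simp add: closed_loop_matrix_def y_def k_def matrix_vector_mult_diff_rdistrib
          matrix_vector_mul_assoc)
    finally show ?thesis by (simp add: inner_diff_left Bl)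
  qed
  have vv: "a \<bullet> v = a \<bullet> (X *v w) + a \<bullet> g'" for a by (simp add: v inner_add_right)
  have ric: "y \<bullet> (X *v y) + x \<bullet> (Q *v x) - x \<bullet> (X *v x) = k \<bullet> (M *v k)"
    using dare_quadratic unfolding y_def k_def .
  have ee: "e \<bullet> (M *v e) = u \<bullet> (M *v u) + k \<bullet> (M *v k) + l \<bullet> (M *v l)
      + 2 * (u \<bullet> (M *v k)) + 2 * (u \<bullet> (M *v l)) + 2 * (k \<bullet> (M *v l))"
    unfolding e k_def[symmetric] l_def[symmetric]
    by (simp add: matrix_vector_right_distrib inner_add_left inner_add_right
        Msym[of k u] Msym[of l u] Msym[of l k])
  have "x' = y + w + Bu *v u" by (simp add: x' y_def)
  hence xx: "x' \<bullet> (X *v x') = y \<bullet> (X *v y) + w \<bullet> (X *v w) + (Bu *v u) \<bullet> (X *v (Bu *v u))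
      + 2 * (y \<bullet> (X *v w)) + 2 * (u \<bullet> (M *v k)) + 2 * ((Bu *v u) \<bullet> (X *v w))"
    by (simp add: matrix_vector_right_distrib inner_add_left inner_add_right
        Xsym[of w y] Xsym[of w "Bu *v u"] Xsym[of y "Bu *v u"] Bk)
  have "x' \<bullet> g' = y \<bullet> g' + w \<bullet> g' + (Bu *v u) \<bullet> g'"
    by (simp add: x' y_def inner_add_left)
  with M_quadratic[of u] xg vv[of y] vv[of "Bu *v u"] ric ee xx Bl[of u]
  show ?thesis unfolding l_def[symmetric] by linarith
qed

section \<open>The non-causal controller and its truncations\<close>

definition feedforward_kernel :: "nat \<Rightarrow> real^'d \<Rightarrow> real^'x" where
  "feedforward_kernel i w = ((*v) (transpose Acl) ^^ i) (X *v (Bd *v w))"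

text \<open>The non-causal controller and its truncations differ only in the kernel that weights the disturbance
  \<open>i\<close> steps ahead of the current time \<open>length xs - 1\<close>.\<close>

definition kernel_controller :: "(nat \<Rightarrow> real^'d \<Rightarrow> real^'x) \<Rightarrow> ('x, 'd, 'u) controller" where
  "kernel_controller H xs d =
     - (Kx *v last xs) - Kv *v (\<Sum>i. H i (d (length xs - 1 + i)))"

definition truncated_kernel :: "nat \<Rightarrow> nat \<Rightarrow> real^'d \<Rightarrow> real^'x" where
  "truncated_kernel p i = (if i \<le> p then feedforward_kernel i else (\<lambda>w. 0))"

text \<open>The vector \<open>v\<close> of the completion of squares at time \<open>t\<close>.\<close>

definition costate :: "(nat \<Rightarrow> real^'d) \<Rightarrow> nat \<Rightarrow> real^'x" where
  "costate d t = (\<Sum>i. feedforward_kernel i (d (t + i)))"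

text \<open>The departure of the applied input from the non-causal law, evaluated along the trajectory of \<open>K\<close>
  itself, not along the optimal trajectory.\<close>

definition deviation :: "('x, 'd, 'u) controller \<Rightarrow> (nat \<Rightarrow> real^'d) \<Rightarrow> nat \<Rightarrow> real^'u" where
  "deviation K d t =
     control A Bd Bu K 0 d t + Kx *v state A Bd Bu K 0 d t + Kv *v costate d t"

lemma noncausal_controller_kernel:
  "noncausal_controller A Bd Bu R X = kernel_controller feedforward_kernel"
  by (intro ext) (simp add: noncausal_controller_def kernel_controller_def feedforward_kernel_def)

lemma preview_truncated: "preview_controller p (kernel_controller (truncated_kernel p))"
  unfolding preview_controller_def
proof (intro allI impI, elim conjE)
  fix t and xs :: "(real^'x) list" and d d' :: "nat \<Rightarrow> real^'d"
  assume "length xs = t + 1" "\<forall>s\<le>t + p. d s = d' s"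
  hence "truncated_kernel p i (d (length xs - 1 + i)) = truncated_kernel p i (d' (length xs - 1 + i))" for i
    by (auto simp: truncated_kernel_def)
  thus "kernel_controller (truncated_kernel p) xs d = kernel_controller (truncated_kernel p) xs d'"
    unfolding kernel_controller_def by presburger
qed

lemma control_kernel_controller:
  "control A Bd Bu (kernel_controller H) x0 d t
     = - (Kx *v state A Bd Bu (kernel_controller H) x0 d t) - Kv *v (\<Sum>i. H i (d (t + i)))"
  by (simp add: control_def state_def kernel_controller_def length_state_history)

text \<open>A single sequence for the kernel and for the powers of the closed-loop matrix saves carrying two
  constants through the stability proof.\<close>

lemma feedforward_kernel_bound:
  obtains h where "\<And>i. 0 \<le> h i" and "summable h"
    and "\<And>i w. norm (feedforward_kernel i w) \<le> h i * norm w"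
    and "\<And>i x. norm (((*v) Acl ^^ i) x) \<le> h i * norm x"
proof -
  have "schur Acl" using dare by (simp add: stabilizing_dare_solution_def)
  then obtain g where g: "\<And>k. 0 \<le> g k" "summable g"
    "\<And>k x. norm (((*v) Acl ^^ k) x) \<le> g k * norm x"
    "\<And>k x. norm (((*v) (transpose Acl) ^^ k) x) \<le> g k * norm x"
    by (rule schur_summable_power_bound) (rule that)
  define c where "c = 1 + onorm ((*v) (X ** Bd))"
  have "0 \<le> onorm ((*v) (X ** Bd))" by (intro onorm_pos_le matrix_vector_mul_bounded_linear)
  hence c: "1 \<le> c" by (simp add: c_def)
  show thesis
  proof (rule that[of "\<lambda>i. g i * c"])
    show "0 \<le> g i * c" for i using g(1)[of i] c by simp
    show "summable (\<lambda>i. g i * c)" using g(2) by (rule summable_mult2)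
    show "norm (feedforward_kernel i w) \<le> g i * c * norm w" for i w
    proof -
      have "norm ((X ** Bd) *v w) \<le> c * norm w"
        using norm_mult_vec_le[of "X ** Bd" w] norm_ge_zero[of w] by (simp add: c_def ring_distribs add_increasing)
      hence "g i * norm ((X ** Bd) *v w) \<le> g i * (c * norm w)" by (intro mult_left_mono g)
      with g(4)[of i "(X ** Bd) *v w"] show ?thesis
        by (simp add: feedforward_kernel_def matrix_vector_mul_assoc mult.assoc)
    qed
    show "norm (((*v) Acl ^^ i) x) \<le> g i * c * norm x" for i x
    proof -
      have "g i * norm x \<le> g i * c * norm x" using c g(1)[of i]
        by (intro mult_right_mono) (auto simp: mult_le_cancel_left1)
      thus ?thesis using g(3)[of i x] by linarith
    qed
  qed
qed

text \<open>Splitting off the first term of the series gives the backward recursion of the completion of squares.\<close>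

lemma costate_recursion:
  assumes "d \<in> l2"
  shows "costate d t = X *v (Bd *v d t) + transpose Acl *v costate d (Suc t)"
proof -
  obtain h where h: "\<And>i. 0 \<le> h i" "summable h"
    "\<And>i w. norm (feedforward_kernel i w) \<le> h i * norm w"
    by (rule feedforward_kernel_bound) (rule that)
  note sm = anticausal_convolution_l2(1)[OF h assms]
  have "costate d t = feedforward_kernel 0 (d t) + (\<Sum>i. feedforward_kernel (Suc i) (d (Suc t + i)))"
    unfolding costate_def using suminf_split_head[OF sm[of t]] by simp
  also have "(\<Sum>i. feedforward_kernel (Suc i) (d (Suc t + i)))
      = (\<Sum>i. transpose Acl *v feedforward_kernel i (d (Suc t + i)))"
    by (simp add: feedforward_kernel_def)
  also have "\<dots> = transpose Acl *v costate d (Suc t)"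
    unfolding costate_def
    by (rule bounded_linear.suminf[OF matrix_vector_mul_bounded_linear sm, symmetric])
  finally show ?thesis by (simp add: feedforward_kernel_def)
qed

lemma costate_l2:
  assumes "d \<in> l2"
  shows "costate d \<in> l2"
proof -
  obtain h where h: "\<And>i. 0 \<le> h i" "summable h"
    "\<And>i w. norm (feedforward_kernel i w) \<le> h i * norm w"
    by (rule feedforward_kernel_bound) (rule that)
  show ?thesis
    using anticausal_convolution_l2(2)[OF h assms] unfolding costate_def[abs_def] .
qed

text \<open>The feedforward term is an \<open>l2\<close> signal by the anticausal estimate and enters the Schur-stable system
  \<open>Acl\<close> as an additional disturbance. Truncation can only shrink the kernel, so the non-causal
  controller and all its truncations are covered at once.\<close>

lemma kernel_controller_stabilizing:
  assumes H: "\<And>i w. norm (H i w) \<le> norm (feedforward_kernel i w)"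
  shows "stabilizing A Bd Bu (kernel_controller H)"
proof -
  obtain h where h: "\<And>i. 0 \<le> h i" "summable h"
    "\<And>i w. norm (feedforward_kernel i w) \<le> h i * norm w"
    "\<And>i x. norm (((*v) Acl ^^ i) x) \<le> h i * norm x"
    by (rule feedforward_kernel_bound) (rule that)
  have Hh: "norm (H i w) \<le> h i * norm w" for i w using H h(3) order_trans by blast
  define G where "G = (suminf h)\<^sup>2"
  define c1 where "c1 = 2 * (onorm ((*v) Bd))\<^sup>2 + 2 * (onorm ((*v) (Bu ** Kv)))\<^sup>2 * G"
  define c2 where "c2 = G * (1 + c1)"
  define c where "c = c2 + (2 * (onorm ((*v) Kx))\<^sup>2 * c2 + 2 * (onorm ((*v) Kv))\<^sup>2 * G)"
  have G0: "0 \<le> G" by (simp add: G_def)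
  hence c10: "0 \<le> c1" by (simp add: c1_def)
  hence c20: "0 \<le> c2" using G0 by (simp add: c2_def)
  show ?thesis unfolding stabilizing_def
  proof (intro exI[of _ c] allI ballI)
    fix x0 :: "real^'x" and d :: "nat \<Rightarrow> real^'d" assume d: "d \<in> l2"
    let ?x = "state A Bd Bu (kernel_controller H) x0 d"
    let ?u = "control A Bd Bu (kernel_controller H) x0 d"
    define r where "r t = (\<Sum>i. H i (d (t + i)))" for t
    have r: "r \<in> l2" "energy r \<le> G * energy d"
      using anticausal_convolution_l2(2,3)[OF h(1,2) Hh d] by (simp_all add: r_def[abs_def] G_def)
    have u: "?u t = - (Kx *v ?x t) - Kv *v r t" for t
      by (simp add: control_kernel_controller r_def)
    define f where "f t = Bd *v d t - (Bu ** Kv) *v r t" for t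
    have "norm (f t) \<le> onorm ((*v) Bd) * norm (d t) + onorm ((*v) (Bu ** Kv)) * norm (r t)" for t
      unfolding f_def by (rule order_trans[OF norm_triangle_ineq4 add_mono[OF norm_mult_vec_le norm_mult_vec_le]])
    note f = l2_dominated[OF d r(1) this]
    have fe: "energy f \<le> c1 * energy d"
      using f(2) mult_left_mono[OF r(2), of "2 * (onorm ((*v) (Bu ** Kv)))\<^sup>2"]
      by (simp add: c1_def ring_distribs mult.assoc)
    define b where "b t = (case t of 0 \<Rightarrow> x0 | Suc s \<Rightarrow> f s)" for t
    have "summable (\<lambda>t. (norm (b (Suc t)))\<^sup>2)" using f(1) by (simp add: b_def l2_def)
    hence sb: "summable (\<lambda>t. (norm (b t))\<^sup>2)" by (rule iffD1[OF summable_Suc_iff])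
    hence b: "b \<in> l2" by (simp add: l2_def)
    have be: "energy b = (norm x0)\<^sup>2 + energy f"
      using suminf_split_head[OF sb] by (simp add: energy_def b_def)
    have rec: "?x (Suc t) = Acl *v ?x t + b (Suc t)" for t
      by (simp add: state_dynamics u b_def f_def closed_loop_matrix_def matrix_vector_mult_diff_rdistrib
          matrix_vector_mul_assoc[symmetric] matrix_vector_mult_diff_distrib matrix_vector_right_distrib
          linear_neg[OF matrix_vector_mul_linear])
    have "?x 0 = b 0" by (simp add: b_def state_dynamics)
    note x = stable_recursion_l2[OF h(1,2,4) b this rec, folded G_def]
    have "energy b \<le> (1 + c1) * ((norm x0)\<^sup>2 + energy d)"
      using be fe energy_nonneg[OF d] mult_nonneg_nonneg[OF c10, of "(norm x0)\<^sup>2"]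
      by (simp add: ring_distribs)
    hence xe: "energy ?x \<le> c2 * ((norm x0)\<^sup>2 + energy d)"
      using x(2) mult_left_mono[OF _ G0] unfolding c2_def mult.assoc by (meson order_trans)
    have "norm (?u t) \<le> onorm ((*v) Kx) * norm (?x t) + onorm ((*v) Kv) * norm (r t)" for t
      unfolding u using norm_mult_vec_le[of Kx "?x t"] norm_mult_vec_le[of Kv "r t"]
        norm_triangle_ineq4[of "- (Kx *v ?x t)" "Kv *v r t"] by simp
    note ul = l2_dominated[OF x(1) r(1) this]
    have "energy ?u \<le> 2 * (onorm ((*v) Kx))\<^sup>2 * (c2 * ((norm x0)\<^sup>2 + energy d))
        + 2 * (onorm ((*v) Kv))\<^sup>2 * (G * ((norm x0)\<^sup>2 + energy d))"
      by (rule order_trans[OF ul(2)], intro add_mono mult_left_mono xe order_trans[OF r(2)])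
        (use G0 in auto)
    hence "energy ?x + energy ?u \<le> c * ((norm x0)\<^sup>2 + energy d)"
      using xe by (simp add: c_def algebra_simps)
    with x(1) ul(1) show "?x \<in> l2 \<and> ?u \<in> l2 \<and> energy ?x + energy ?u \<le> c * ((norm x0)\<^sup>2 + energy d)"
      by blast
  qed
qed

lemma noncausal_stabilizing: "stabilizing A Bd Bu (kernel_controller feedforward_kernel)"
  by (rule kernel_controller_stabilizing) simp

lemma truncated_stabilizing: "stabilizing A Bd Bu (kernel_controller (truncated_kernel p))"
  by (rule kernel_controller_stabilizing) (simp add: truncated_kernel_def)

section \<open>The cost gap\<close>

text \<open>Telescoping the completion of squares from \<open>x(0) = 0\<close>. The middle sum depends on \<open>d\<close> alone.\<close>

lemma cost_partial_sum:
  fixes K :: "('x, 'd, 'u) controller"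
  assumes d: "d \<in> l2"
  defines "x \<equiv> state A Bd Bu K 0 d" and "u \<equiv> control A Bd Bu K 0 d"
  shows "(\<Sum>t<T. x t \<bullet> (Q *v x t) + u t \<bullet> (R *v u t))
       = (\<Sum>t<T. deviation K d t \<bullet> (M *v deviation K d t))
         + (\<Sum>t<T. (Bd *v d t) \<bullet> (X *v (Bd *v d t)) + 2 * ((Bd *v d t) \<bullet> (transpose Acl *v costate d (Suc t)))
              - (Kv *v costate d t) \<bullet> (M *v (Kv *v costate d t)))
         - (x T \<bullet> (X *v x T) + 2 * (x T \<bullet> (transpose Acl *v costate d T)))"
proof (induction T)
  case 0
  show ?case by (simp add: x_def state_dynamics)
next
  case (Suc T)
  have x': "x (Suc T) = A *v x T + Bd *v d T + Bu *v u T" by (simp add: x_def u_def state_dynamics)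
  have e: "deviation K d T = u T + Kx *v x T + Kv *v costate d T"
    by (simp add: deviation_def x_def u_def)
  show ?case
    using Suc completion_of_squares[OF costate_recursion[OF d] refl x' e] by simp
qed

text \<open>Subtracting the partial sums for \<open>K\<close> and \<open>K'\<close> cancels the part that depends on \<open>d\<close> alone, and
  the boundary terms vanish in the limit because states and costates are in \<open>l2\<close>.\<close>

lemma cost_gap:
  fixes K K' :: "('x, 'd, 'u) controller"
  assumes d: "d \<in> l2" and K: "stabilizing A Bd Bu K" and K': "stabilizing A Bd Bu K'"
    and K'0: "\<And>t. deviation K' d t = 0"
  shows "(\<lambda>t. deviation K d t \<bullet> (M *v deviation K d t))
           sums (cost A Bd Bu Q R K d - cost A Bd Bu Q R K' d)"
proof -
  define S where "S L T = (\<Sum>t<T. state A Bd Bu L 0 d t \<bullet> (Q *v state A Bd Bu L 0 d t)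
     + control A Bd Bu L 0 d t \<bullet> (R *v control A Bd Bu L 0 d t))" for L T
  define V where "V L T = state A Bd Bu L 0 d T \<bullet> (X *v state A Bd Bu L 0 d T)
     + 2 * (state A Bd Bu L 0 d T \<bullet> (transpose Acl *v costate d T))" for L T
  have l2: "state A Bd Bu L 0 d \<in> l2" "control A Bd Bu L 0 d \<in> l2" if "stabilizing A Bd Bu L" for L
    using that d by (auto simp: stabilizing_def)
  have S: "S L \<longlonglongrightarrow> cost A Bd Bu Q R L d" if "stabilizing A Bd Bu L" for L
    unfolding S_def cost_def
    by (intro summable_LIMSEQ summable_add summable_quadratic_form l2 that)
  have mv: "(\<lambda>t. P *v f t) \<longlonglongrightarrow> 0" if "f \<longlonglongrightarrow> 0" for P :: "real^'x^'x" and f :: "nat \<Rightarrow> real^'x"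
    using bounded_linear.tendsto[OF matrix_vector_mul_bounded_linear that, of P] by simp
  have V: "V L \<longlonglongrightarrow> 0" if "stabilizing A Bd Bu L" for L
  proof -
    have x: "state A Bd Bu L 0 d \<longlonglongrightarrow> 0" by (rule l2_tendsto_0[OF l2(1)[OF that]])
    have v: "costate d \<longlonglongrightarrow> 0" by (rule l2_tendsto_0[OF costate_l2[OF d]])
    have "V L \<longlonglongrightarrow> 0 \<bullet> (0::real^'x) + 2 * (0 \<bullet> (0::real^'x))"
      unfolding V_def by (intro tendsto_intros x mv v)
    thus ?thesis by simp
  qed
  have "(\<Sum>t<T. deviation K d t \<bullet> (M *v deviation K d t)) = S K T - S K' T + V K T - V K' T" for T
    unfolding S_def V_def cost_partial_sum[OF d] by (simp add: K'0)
  moreover have "(\<lambda>T. S K T - S K' T + V K T - V K' T)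
      \<longlonglongrightarrow> cost A Bd Bu Q R K d - cost A Bd Bu Q R K' d + 0 - 0"
    by (intro tendsto_intros S V K K')
  ultimately show ?thesis by (simp add: sums_def)
qed

text \<open>The deviation of a truncated controller is \<open>Kv\<close> applied to the discarded tail of the feedforward
  series, and Young's inequality bounds the energy of this tail by that of \<open>d\<close> times the square of the
  tail sum of the kernel bound. Nonnegativity follows from the same formula for the gap, since \<open>M\<close> is
  positive definite.\<close>

lemma truncated_regret_bound:
  obtains c where "c \<longlonglongrightarrow> 0"
    and "\<And>p d. d \<in> l2 \<Longrightarrow>
      0 \<le> cost A Bd Bu Q R (kernel_controller (truncated_kernel p)) d
           - cost A Bd Bu Q R (noncausal_controller A Bd Bu R X) d"
    and "\<And>p d. d \<in> l2 \<Longrightarrow>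
      cost A Bd Bu Q R (kernel_controller (truncated_kernel p)) d
        - cost A Bd Bu Q R (noncausal_controller A Bd Bu R X) d \<le> c p * energy d"
proof -
  obtain h where h: "\<And>i. 0 \<le> h i" "summable h"
    "\<And>i w. norm (feedforward_kernel i w) \<le> h i * norm w"
    by (rule feedforward_kernel_bound) (rule that)
  define \<tau> where "\<tau> p i = (if i \<le> p then 0 else h i)" for p i
  define c where "c p = onorm ((*v) M) * (2 * (onorm ((*v) Kv))\<^sup>2 * (suminf (\<tau> p))\<^sup>2)" for p
  have M0: "0 \<le> onorm ((*v) M)" by (intro onorm_pos_le matrix_vector_mul_bounded_linear)
  have "(\<lambda>p. suminf (\<tau> p)) \<longlonglongrightarrow> 0"
    unfolding \<tau>_def by (rule suminf_tail_tendsto_0) (rule h)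
  hence "c \<longlonglongrightarrow> onorm ((*v) M) * (2 * (onorm ((*v) Kv))\<^sup>2 * 0\<^sup>2)"
    unfolding c_def by (intro tendsto_intros)
  hence c: "c \<longlonglongrightarrow> 0" by simp
  have \<tau>: "0 \<le> \<tau> p i" "summable (\<tau> p)" for p i
  proof -
    show "0 \<le> \<tau> p i" using h by (simp add: \<tau>_def)
    show "summable (\<tau> p)"
      by (rule summable_comparison_test'[OF h(2), of 0]) (use h in \<open>auto simp: \<tau>_def\<close>)
  qed
  have gap: "0 \<le> cost A Bd Bu Q R (kernel_controller (truncated_kernel p)) d
           - cost A Bd Bu Q R (noncausal_controller A Bd Bu R X) d \<and>
      cost A Bd Bu Q R (kernel_controller (truncated_kernel p)) d
        - cost A Bd Bu Q R (noncausal_controller A Bd Bu R X) d \<le> c p * energy d"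
    if d: "d \<in> l2" for p and d :: "nat \<Rightarrow> real^'d"
  proof -
    let ?K = "kernel_controller (truncated_kernel p)"
    define D where "D i w = (if i \<le> p then 0 else feedforward_kernel i w)" for i w
    have D: "norm (D i w) \<le> \<tau> p i * norm w" for i w
      using h by (simp add: D_def \<tau>_def)
    note conv = anticausal_convolution_l2[OF \<tau> D d]
    define r where "r t = (\<Sum>i. D i (d (t + i)))" for t
    have smT: "summable (\<lambda>i. truncated_kernel p i (d (t + i)))" for t
      by (rule anticausal_convolution_l2(1)[OF h(1,2) _ d])
        (use h in \<open>auto simp: truncated_kernel_def\<close>)
    have "costate d t = (\<Sum>i. truncated_kernel p i (d (t + i))) + r t" for t
      unfolding costate_def r_def suminf_add[OF smT conv(1)]
      by (intro suminf_cong) (simp add: truncated_kernel_def D_def)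
    hence e: "deviation ?K d t = Kv *v r t" for t
      by (simp add: deviation_def control_kernel_controller matrix_vector_right_distrib)
    \<comment> \<open>The summand of weight zero brings the bound into the two-term form of \<open>l2_dominated\<close>.\<close>
    have "norm (deviation ?K d t) \<le> onorm ((*v) Kv) * norm (r t) + 0 * norm (r t)" for t
      unfolding e using norm_mult_vec_le[of Kv "r t"] by simp
    note dev = l2_dominated[OF conv(2)[folded r_def] conv(2)[folded r_def] this]
    have "energy (deviation ?K d) \<le> 2 * (onorm ((*v) Kv))\<^sup>2 * ((suminf (\<tau> p))\<^sup>2 * energy d)"
      using dev(2) mult_left_mono[OF conv(3)[folded r_def], of "2 * (onorm ((*v) Kv))\<^sup>2"] by simp
    hence ub: "onorm ((*v) M) * energy (deviation ?K d) \<le> c p * energy d"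
      using mult_left_mono[OF _ M0] unfolding c_def mult.assoc by blast
    have "deviation (kernel_controller feedforward_kernel) d t = 0" for t
      by (simp add: deviation_def control_kernel_controller costate_def)
    note gap = cost_gap[OF d truncated_stabilizing noncausal_stabilizing this, of p,
        folded noncausal_controller_kernel]
    have "0 \<le> (\<Sum>t. deviation ?K d t \<bullet> (M *v deviation ?K d t))"
      by (intro suminf_nonneg sums_summable[OF gap] M_nonneg)
    with quadratic_form_suminf_le[OF dev(1), of M] ub sums_unique[OF gap] show ?thesis by linarith
  qed
  show thesis
    by (rule that[of c]) (use gap c in auto)
qed

lemma eventually_truncated_gap:
  assumes "0 < \<epsilon>"
  shows "\<forall>\<^sub>F p in sequentially. \<forall>d\<in>l2. d \<noteq> (\<lambda>t. 0) \<longrightarrow>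
      0 \<le> cost A Bd Bu Q R (kernel_controller (truncated_kernel p)) d
           - cost A Bd Bu Q R (noncausal_controller A Bd Bu R X) d \<and>
      cost A Bd Bu Q R (kernel_controller (truncated_kernel p)) d
        - cost A Bd Bu Q R (noncausal_controller A Bd Bu R X) d < \<epsilon> * energy d"
proof -
  obtain c where c: "c \<longlonglongrightarrow> 0"
    and lower: "\<And>p d. d \<in> l2 \<Longrightarrow>
      0 \<le> cost A Bd Bu Q R (kernel_controller (truncated_kernel p)) d
           - cost A Bd Bu Q R (noncausal_controller A Bd Bu R X) d"
    and upper: "\<And>p d. d \<in> l2 \<Longrightarrow>
      cost A Bd Bu Q R (kernel_controller (truncated_kernel p)) d
        - cost A Bd Bu Q R (noncausal_controller A Bd Bu R X) d \<le> c p * energy d"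
    by (rule truncated_regret_bound) (rule that)
  have "\<forall>\<^sub>F p in sequentially. c p < \<epsilon>" using c assms by (rule order_tendstoD)
  thus ?thesis
  proof (rule eventually_mono)
    fix p assume p: "c p < \<epsilon>"
    have "c p * energy d < \<epsilon> * energy d" if "d \<in> l2" "d \<noteq> (\<lambda>t. 0)" for d :: "nat \<Rightarrow> real^'d"
      using p energy_pos[OF that] by simp
    thus "\<forall>d\<in>l2. d \<noteq> (\<lambda>t. 0) \<longrightarrow>
      0 \<le> cost A Bd Bu Q R (kernel_controller (truncated_kernel p)) d
           - cost A Bd Bu Q R (noncausal_controller A Bd Bu R X) d \<and>
      cost A Bd Bu Q R (kernel_controller (truncated_kernel p)) d
        - cost A Bd Bu Q R (noncausal_controller A Bd Bu R X) d < \<epsilon> * energy d"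
      using lower upper by (meson le_less_trans)
  qed
qed

lemma optimal_regret_tendsto_0:
  "optimal_regret A Bd Bu Q R (noncausal_controller A Bd Bu R X) \<longlonglongrightarrow> 0"
proof (rule order_tendstoI)
  fix a :: ereal assume "a < 0"
  have "0 \<le> optimal_regret A Bd Bu Q R (noncausal_controller A Bd Bu R X) p" for p
    unfolding optimal_regret_def by (intro INF_greatest) auto
  with \<open>a < 0\<close> show "\<forall>\<^sub>F p in sequentially.
      a < optimal_regret A Bd Bu Q R (noncausal_controller A Bd Bu R X) p"
    by (auto intro: always_eventually less_le_trans)
next
  fix a :: ereal assume "0 < a"
  then obtain \<gamma> where \<gamma>: "0 < ereal \<gamma>" "ereal \<gamma> < a" using ereal_dense2 by blast
  hence "0 < \<gamma>\<^sup>2" by simp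
  from eventually_truncated_gap[OF this]
  show "\<forall>\<^sub>F p in sequentially. optimal_regret A Bd Bu Q R (noncausal_controller A Bd Bu R X) p < a"
  proof (rule eventually_mono)
    fix p assume gap: "\<forall>d\<in>l2. d \<noteq> (\<lambda>t. 0) \<longrightarrow>
      0 \<le> cost A Bd Bu Q R (kernel_controller (truncated_kernel p)) d
           - cost A Bd Bu Q R (noncausal_controller A Bd Bu R X) d \<and>
      cost A Bd Bu Q R (kernel_controller (truncated_kernel p)) d
        - cost A Bd Bu Q R (noncausal_controller A Bd Bu R X) d < \<gamma>\<^sup>2 * energy d"
    hence "achieves_regret A Bd Bu Q R (noncausal_controller A Bd Bu R X)
        (kernel_controller (truncated_kernel p)) \<gamma>"
      unfolding achieves_regret_def using truncated_stabilizing by blast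
    hence "optimal_regret A Bd Bu Q R (noncausal_controller A Bd Bu R X) p \<le> ereal \<gamma>"
      unfolding optimal_regret_def using \<gamma> preview_truncated by (intro INF_lower) auto
    thus "optimal_regret A Bd Bu Q R (noncausal_controller A Bd Bu R X) p < a"
      using \<gamma>(2) by (rule le_less_trans)
  qed
qed

end

theorem theorem5:
  fixes A :: "real^'x^'x" and Bd :: "real^'d^'x" and Bu :: "real^'u^'x"
    and Q :: "real^'x^'x" and R :: "real^'u^'u" and X :: "real^'x^'x"
    and Knc :: "('x::finite, 'd::finite, 'u::finite) controller"
  assumes "psd Q" and "posdef R"
    and "stabilizable A Bu"
    and "invertible A"
    and "no_unobservable_modes_on_unit_circle A Q"
    and "stabilizing_dare_solution A Bu Q R X"
    and "Knc = noncausal_controller A Bd Bu R X"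
  shows "((\<lambda>p. optimal_regret A Bd Bu Q R Knc p) \<longlonglongrightarrow> 0) \<and>
         (\<forall>\<epsilon>::real. \<epsilon> > 0 \<longrightarrow>
           (\<exists>p K. preview_controller p K \<and> stabilizing A Bd Bu K \<and>
              (\<forall>d\<in>l2. d \<noteq> (\<lambda>t. 0) \<longrightarrow>
                 0 \<le> cost A Bd Bu Q R K d - cost A Bd Bu Q R Knc d \<and>
                 cost A Bd Bu Q R K d - cost A Bd Bu Q R Knc d < \<epsilon> * energy d)))"
proof -
  interpret dare_solution A Bd Bu Q R X using assms by unfold_locales
  show ?thesis
  proof (intro conjI allI impI)
    show "(\<lambda>p. optimal_regret A Bd Bu Q R Knc p) \<longlonglongrightarrow> 0"
      using optimal_regret_tendsto_0 by (simp add: assms(7))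
  next
    fix \<epsilon> :: real assume "0 < \<epsilon>"
    then obtain p where "\<forall>d\<in>l2. d \<noteq> (\<lambda>t. 0) \<longrightarrow>
      0 \<le> cost A Bd Bu Q R (kernel_controller (truncated_kernel p)) d - cost A Bd Bu Q R Knc d \<and>
      cost A Bd Bu Q R (kernel_controller (truncated_kernel p)) d - cost A Bd Bu Q R Knc d < \<epsilon> * energy d"
      using eventually_happens'[OF sequentially_bot eventually_truncated_gap] unfolding assms(7) by blast
    thus "\<exists>p K. preview_controller p K \<and> stabilizing A Bd Bu K \<and>
              (\<forall>d\<in>l2. d \<noteq> (\<lambda>t. 0) \<longrightarrow>
                 0 \<le> cost A Bd Bu Q R K d - cost A Bd Bu Q R Knc d \<and>
                 cost A Bd Bu Q R K d - cost A Bd Bu Q R Knc d < \<epsilon> * energy d)"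
      using preview_truncated truncated_stabilizing by blast
  qed
qed

end
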